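(* For positive integers $n$ and $d$ with $n \ge 3$, we have $c'_{d-1}(H(d,n)) \ge \left\lceil \frac{n}{d+1} \right\rceil$.
   Context: Graphs are finite and simple. For positive integers $d,n$, the Hamming graph $H(d,n)$ is the $d$-fold Cartesian product of $K_n$: its vertices are the $d$-tuples with entries in $\{1,\dots,n\}$, two being adjacent iff they differ in exactly one coordinate. $\ell$-visibility Cops and Robbers on a graph $G$ ($\ell$ a nonnegative integer): a team of one or more cops and a single robber occupy vertices of $G$ (several cops may share a vertex). First the cops choose initial positions, then the robber, knowing them, chooses his. Thereafter the game proceeds in rounds, each a cop turn (each cop stays or moves to an adjacent vertex) followed by a robber turn (the robber stays or moves to an adjacent vertex). The robber always knows the cops' positions. The robber's position is unknown to the cops unless some cop is at distance at most $\ell$ from him; in that case the cops see the robber and all cops know his position. (A cop sees a vertex if she is within distance $\ell$ of it.) $c'_\ell(G)$ denotes the minimum number of cops having a strategy that guarantees that, within a finite number of rounds and regardless of how the robber plays (equivalently, even if he can anticipate the cops' moves), some cop sees the robber. Equivalently, it is the least $k$ for which $k$ cops can clean all vertices: after the initial placement the dirty vertices are those not within distance $\ell$ of a cop; in each cop turn, dirty vertices that are seen by cops in their new positions become clean; in each robber turn, every clean vertex that is adjacent to a dirty vertex and is not within distance $\ell$ of a cop becomes dirty. *)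

theory Defs
  imports "Graph_Theory.Graph_Theory"
begin

section \<open>Hamming graphs\<close>

definition hamming_graph :: "nat \<Rightarrow> nat \<Rightarrow> nat list pair_pre_digraph" where
  "hamming_graph d n =
    (let V = {xs. length xs = d \<and> set xs \<subseteq> {1..n}}
     in \<lparr> pverts = V,
          parcs = {(xs, ys). xs \<in> V \<and> ys \<in> V \<and> card {i. i < d \<and> xs ! i \<noteq> ys ! i} = 1} \<rparr>)"

lemma pair_graph_hamming_graph: "pair_graph (hamming_graph d n)"
proof -
  let ?G = "hamming_graph d n"
  have "pverts ?G = {xs. set xs \<subseteq> {1..n} \<and> length xs = d}"
    by (auto simp: hamming_graph_def Let_def)
  then have fin: "finite (pverts ?G)"
    using finite_lists_length_eq[of "{1..n}" d] by simp
  have sub: "e \<in> pverts ?G \<times> pverts ?G" if "e \<in> parcs ?G" for e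
    using that by (auto simp: hamming_graph_def Let_def)
  have loop: "fst e \<noteq> snd e" if "e \<in> parcs ?G" for e
  proof
    assume "fst e = snd e"
    then have "{i. i < d \<and> fst e ! i \<noteq> snd e ! i} = {}"
      by simp
    moreover have "card {i. i < d \<and> fst e ! i \<noteq> snd e ! i} = 1"
      using that by (simp only: hamming_graph_def Let_def pair_pre_digraph.simps mem_Collect_eq case_prod_beta)
    ultimately show False
      by (metis card.empty zero_neq_one)
  qed
  have sym: "(y, x) \<in> parcs ?G" if "(x, y) \<in> parcs ?G" for x y
  proof -
    have "{i. i < d \<and> y ! i \<noteq> x ! i} = {i. i < d \<and> x ! i \<noteq> y ! i}"
      by (rule Collect_cong) (simp add: eq_commute[of "y ! _"])
    with that show ?thesis
      by (simp add: hamming_graph_def Let_def)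
  qed
  show ?thesis
  proof
    show "finite (parcs ?G)"
      by (rule finite_subset[OF subsetI[OF sub] finite_cartesian_product[OF fin fin]])
    show "symmetric (with_proj ?G)"
      unfolding symmetric_def with_proj_simps by (rule symI) (rule sym)
    show "fst e \<in> pverts ?G" "snd e \<in> pverts ?G" "fst e \<noteq> snd e" if "e \<in> parcs ?G" for e
      using sub[OF that] loop[OF that] by (auto simp: mem_Times_iff)
  qed (fact fin)
qed

section \<open>The game of Cops and Robbers with limited visibility\<close>

text \<open>
  The library's \<open>\<mu>\<close> is the infimum of the costs of walks; with unit costs it is the graph
  distance (infinite between different components).
\<close>

definition graph_dist :: "'a pair_pre_digraph \<Rightarrow> 'a \<Rightarrow> 'a \<Rightarrow> ereal" where
  "graph_dist G u v = wf_digraph.\<mu> (with_proj G) (\<lambda>_. 1) u v"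

definition legal_move :: "'a pair_pre_digraph \<Rightarrow> 'a \<Rightarrow> 'a \<Rightarrow> bool" where
  "legal_move G u v \<longleftrightarrow> v = u \<or> (u, v) \<in> parcs G"

text \<open>
  The positions of a team of \<open>k\<close> cops are given by a function, of which only the values at
  \<open>i < k\<close> matter.
\<close>

definition cops_see ::
    "'a pair_pre_digraph \<Rightarrow> nat \<Rightarrow> nat \<Rightarrow> (nat \<Rightarrow> 'a) \<Rightarrow> 'a \<Rightarrow> bool" where
  "cops_see G l k c v \<longleftrightarrow> (\<exists>i<k. graph_dist G (c i) v \<le> ereal (real l))"

definition observation ::
    "'a pair_pre_digraph \<Rightarrow> nat \<Rightarrow> nat \<Rightarrow> (nat \<Rightarrow> 'a) \<Rightarrow> 'a \<Rightarrow> 'a option" where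
  "observation G l k c v = (if cops_see G l k c v then Some v else None)"

text \<open>
  A strategy of the cops maps the list of all observations made so far to the next
  positions of the cops. Their previous positions are determined by earlier observations and
  need not be part of the argument. The robber's play \<open>r\<close> is the sequence of his positions:
  \<open>r 0\<close> is his initial choice and \<open>r t\<close> his position at the end of round \<open>t\<close>. In every
  round the cops observe twice, after their own turn and after the robber's turn.
\<close>

type_synonym 'a cop_strategy = "'a option list \<Rightarrow> nat \<Rightarrow> 'a"

primrec history ::
    "'a pair_pre_digraph \<Rightarrow> nat \<Rightarrow> nat \<Rightarrow> 'a cop_strategy \<Rightarrow> (nat \<Rightarrow> 'a) \<Rightarrow> nat \<Rightarrow> 'a option list"
where
  "history G l k \<sigma> r 0 = [observation G l k (\<sigma> []) (r 0)]"
| "history G l k \<sigma> r (Suc t) =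
    (let h = history G l k \<sigma> r t
     in h @ [observation G l k (\<sigma> h) (r t), observation G l k (\<sigma> h) (r (Suc t))])"

primrec cop_positions ::
    "'a pair_pre_digraph \<Rightarrow> nat \<Rightarrow> nat \<Rightarrow> 'a cop_strategy \<Rightarrow> (nat \<Rightarrow> 'a) \<Rightarrow> nat \<Rightarrow> nat \<Rightarrow> 'a"
where
  "cop_positions G l k \<sigma> r 0 = \<sigma> []"
| "cop_positions G l k \<sigma> r (Suc t) = \<sigma> (history G l k \<sigma> r t)"

definition robber_play :: "'a pair_pre_digraph \<Rightarrow> (nat \<Rightarrow> 'a) \<Rightarrow> bool" where
  "robber_play G r \<longleftrightarrow> r 0 \<in> pverts G \<and> (\<forall>t. legal_move G (r t) (r (Suc t)))"

definition legal_strategy :: "'a pair_pre_digraph \<Rightarrow> nat \<Rightarrow> nat \<Rightarrow> 'a cop_strategy \<Rightarrow> bool" where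
  "legal_strategy G l k \<sigma> \<longleftrightarrow>
    (\<forall>r. robber_play G r \<longrightarrow>
      (\<forall>i<k. cop_positions G l k \<sigma> r 0 i \<in> pverts G \<and>
        (\<forall>t. legal_move G (cop_positions G l k \<sigma> r t i) (cop_positions G l k \<sigma> r (Suc t) i))))"

text \<open>
  The robber can be seen at the end of a round (including the initial placement), or between
  the cops' turn and his own turn, when the cops have moved but he has not.
\<close>

definition seen_within ::
    "'a pair_pre_digraph \<Rightarrow> nat \<Rightarrow> nat \<Rightarrow> 'a cop_strategy \<Rightarrow> (nat \<Rightarrow> 'a) \<Rightarrow> nat \<Rightarrow> bool"
where
  "seen_within G l k \<sigma> r T \<longleftrightarrow>
    (\<exists>t\<le>T. cops_see G l k (cop_positions G l k \<sigma> r t) (r t)) \<or>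
    (\<exists>t<T. cops_see G l k (cop_positions G l k \<sigma> r (Suc t)) (r t))"

text \<open>
  The robber's play is chosen after the strategy, so he may anticipate the cops' moves.
\<close>

definition can_see_robber :: "'a pair_pre_digraph \<Rightarrow> nat \<Rightarrow> nat \<Rightarrow> bool" where
  "can_see_robber G l k \<longleftrightarrow>
    (\<exists>\<sigma>. legal_strategy G l k \<sigma> \<and>
      (\<exists>T. \<forall>r. robber_play G r \<longrightarrow> seen_within G l k \<sigma> r T))"

definition seeing_cop_number :: "nat \<Rightarrow> 'a pair_pre_digraph \<Rightarrow> nat" where
  "seeing_cop_number l G = (LEAST k. k \<ge> 1 \<and> can_see_robber G l k)"

end

theory Submission
  imports Defs "HOL-Number_Theory.Cong"
begin

text \<open>
  In \<open>H(d,n)\<close> two vertices are at distance at most \<open>d - 1\<close> exactly when they agree in some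
  coordinate, so with visibility \<open>d - 1\<close> the robber stays unseen as long as, in every coordinate,
  his entry differs from those of all the cops.

  The coordinates can therefore be treated separately, except that the robber may change only
  one of them per round. He does so in cyclic order, so an entry chosen for some coordinate stays
  in place for \<open>d\<close> rounds. During this time it has to avoid the cops at \<open>d + 1\<close> consecutive
  times, because in every round the cops move (and look) before the robber does. At each time
  \<open>k\<close> cops block at most \<open>k\<close> entries, so altogether at most \<open>k (d + 1)\<close> entries are blocked, and
  an allowed one exists as soon as \<open>k (d + 1) < n\<close>
  (lemma \<open>hamming_graph_evasion\<close>).

  The robber needs to know the future positions of the cops. He does, because while the
  cops see nothing all their observations are empty, so that their strategy runs through a
  sequence of positions that does not depend on how he plays
  (lemma \<open>not_can_see_robber_if_evasion\<close>).
  Hence \<open>k\<close> cops can succeed only if \<open>k (d + 1) \<ge> n\<close>.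
\<close>

section \<open>Visibility in Hamming graphs\<close>

lemma mem_pverts_hamming_graph:
  "xs \<in> pverts (hamming_graph d n) \<longleftrightarrow> length xs = d \<and> set xs \<subseteq> {1..n}"
  by (simp add: hamming_graph_def Let_def)

lemma mem_parcs_hamming_graph:
  "(xs, ys) \<in> parcs (hamming_graph d n) \<longleftrightarrow>
    xs \<in> pverts (hamming_graph d n) \<and> ys \<in> pverts (hamming_graph d n) \<and>
    card {i. i < d \<and> xs ! i \<noteq> ys ! i} = 1"
  by (simp add: hamming_graph_def Let_def)

lemma card_differences_le_length_awalk:
  assumes "pre_digraph.awalk (with_proj (hamming_graph d n)) u p v"
  shows "card {i. i < d \<and> u ! i \<noteq> v ! i} \<le> length p"
proof -
  interpret pair_graph "hamming_graph d n"
    by (rule pair_graph_hamming_graph)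
  show ?thesis
    using assms
  proof (induction p arbitrary: u)
    case Nil
    then show ?case
      by (simp add: awalk_Nil_iff)
  next
    case (Cons e p)
    obtain x w where e: "e = (x, w)"
      by fastforce
    with Cons.prems have arc: "(u, w) \<in> parcs (hamming_graph d n)" and "awalk w p v"
      by (auto simp: awalk_Cons_iff)
    then have IH: "card {i. i < d \<and> w ! i \<noteq> v ! i} \<le> length p"
      using Cons.IH by blast
    have "{i. i < d \<and> u ! i \<noteq> v ! i} \<subseteq>
        {i. i < d \<and> u ! i \<noteq> w ! i} \<union> {i. i < d \<and> w ! i \<noteq> v ! i}"
      by auto
    then have "card {i. i < d \<and> u ! i \<noteq> v ! i} \<le>
        card ({i. i < d \<and> u ! i \<noteq> w ! i} \<union> {i. i < d \<and> w ! i \<noteq> v ! i})"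
      by (intro card_mono) auto
    also have "\<dots> \<le> card {i. i < d \<and> u ! i \<noteq> w ! i} + card {i. i < d \<and> w ! i \<noteq> v ! i}"
      by (rule card_Un_le)
    finally show ?case
      using arc IH by (simp add: mem_parcs_hamming_graph)
  qed
qed

lemma card_differences_le_graph_dist:
  "ereal (card {i. i < d \<and> u ! i \<noteq> v ! i}) \<le> graph_dist (hamming_graph d n) u v"
proof -
  interpret pair_graph "hamming_graph d n"
    by (rule pair_graph_hamming_graph)
  have cost: "awalk_cost (\<lambda>_. 1) p = real (length p)" for p
    by (induction p) simp_all
  show ?thesis
    unfolding graph_dist_def \<mu>_def
    by (rule INF_greatest) (simp add: cost card_differences_le_length_awalk)
qed

lemma not_cops_see_if_no_agreement:
  assumes "d \<ge> 1"
    and "\<And>i j. i < k \<Longrightarrow> j < d \<Longrightarrow> c i ! j \<noteq> v ! j"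
  shows "\<not> cops_see (hamming_graph d n) (d - 1) k c v"
proof
  assume "cops_see (hamming_graph d n) (d - 1) k c v"
  then obtain i where i: "i < k"
    and dist: "graph_dist (hamming_graph d n) (c i) v \<le> ereal (real (d - 1))"
    unfolding cops_see_def by blast
  have "{j. j < d \<and> c i ! j \<noteq> v ! j} = {..<d}"
    using assms(2) i by auto
  then have "ereal (real d) \<le> graph_dist (hamming_graph d n) (c i) v"
    using card_differences_le_graph_dist[of d "c i" v n] by simp
  also note dist
  finally show False
    using \<open>d \<ge> 1\<close> by simp
qed

section \<open>Blind cops\<close>

text \<open>
  As long as the robber is unseen, the cops' observations carry no information, so
  the strategy is reduced to one fixed sequence of placements. To escape, the robber only has to
  be able to avoid any such sequence that is known to him in advance.
\<close>

lemma not_can_see_robber_if_evasion: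
  assumes evasion: "\<And>C :: nat \<Rightarrow> nat \<Rightarrow> 'a. \<exists>r. robber_play G r \<and>
    (\<forall>t. \<not> cops_see G l k (C t) (r t) \<and> \<not> cops_see G l k (C (Suc t)) (r t))"
  shows "\<not> can_see_robber G l k"
proof
  assume "can_see_robber G l k"
  then obtain \<sigma> T where seen: "\<And>r. robber_play G r \<Longrightarrow> seen_within G l k \<sigma> r T"
    unfolding can_see_robber_def by blast
  \<comment> \<open>There is one observation of the initial placement and there are two in every round,
    so by the time of their turn in round \<open>t + 1\<close> the cops have made \<open>2 t + 1\<close> observations.\<close>
  define C where
    "C t = \<sigma> (case t of 0 \<Rightarrow> [] | Suc s \<Rightarrow> replicate (2 * s + 1) None)" for t
  obtain r where r: "robber_play G r"
    and unseen: "\<And>t. \<not> cops_see G l k (C t) (r t)" "\<And>t. \<not> cops_see G l k (C (Suc t)) (r t)"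
    using evasion[of C] by blast
  have hist: "history G l k \<sigma> r t = replicate (2 * t + 1) None" for t
  proof (induction t)
    case 0
    then show ?case
      using unseen(1)[of 0] by (simp add: observation_def C_def)
  next
    case (Suc t)
    have "\<sigma> (history G l k \<sigma> r t) = C (Suc t)"
      by (simp add: Suc.IH C_def)
    then have "history G l k \<sigma> r (Suc t) = replicate (2 * t + 1) None @ replicate 2 None"
      using unseen(1)[of "Suc t"] unseen(2)[of t]
      by (simp add: Let_def observation_def Suc.IH numeral_2_eq_2)
    also have "\<dots> = replicate (2 * Suc t + 1) None"
      by (simp flip: replicate_add)
    finally show ?case .
  qed
  have "cop_positions G l k \<sigma> r = C"
  proof
    fix t
    show "cop_positions G l k \<sigma> r t = C t"
      by (cases t) (simp_all add: C_def hist del: replicate.simps)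
  qed
  then have "\<not> seen_within G l k \<sigma> r T"
    using unseen unfolding seen_within_def by simp
  then show False
    using seen r by blast
qed

section \<open>Evading a known sequence of placements\<close>

text \<open>
  In the cyclic schedule, \<open>(t + j) div d\<close> counts how often the \<open>j\<close>-th coordinate has been
  renewed up to time \<open>t\<close>; the shift by \<open>j\<close> makes sure that no two coordinates are renewed in
  the same round.
\<close>

lemma hamming_graph_evasion:
  fixes C :: "nat \<Rightarrow> nat \<Rightarrow> nat list"
  assumes d: "d \<ge> 1" and few: "k * (d + 1) < n"
  shows "\<exists>r. robber_play (hamming_graph d n) r \<and>
    (\<forall>t. \<not> cops_see (hamming_graph d n) (d - 1) k (C t) (r t) \<and>
      \<not> cops_see (hamming_graph d n) (d - 1) k (C (Suc t)) (r t))"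
proof -
  define allowed where "allowed j q x \<longleftrightarrow> x \<in> {1..n} \<and>
    (\<forall>i<k. \<forall>m. q * d \<le> m + j \<and> m + j \<le> q * d + d \<longrightarrow> C m i ! j \<noteq> x)" for j q x
  have "\<exists>x. allowed j q x" for j q
  proof -
    \<comment> \<open>\<open>f (i, s)\<close> is the entry of cop \<open>i\<close> at the time \<open>m\<close> with \<open>m + j = q * d + s\<close>. For \<open>q = 0\<close>
      and \<open>s < j\<close> there is no such time, and truncated subtraction gives an entry at time \<open>0\<close>,
      which is harmless because there are still at most \<open>k (d + 1)\<close> blocked entries.\<close>
    define f where "f = (\<lambda>(i, s). C (q * d + s - j) i ! j)"
    let ?B = "f ` ({..<k} \<times> {..d})"
    have "card ?B \<le> card ({..<k} \<times> {..d})"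
      by (intro card_image_le) simp
    also have "\<dots> < card {1..n}"
      using few by simp
    finally have "\<not> {1..n} \<subseteq> ?B"
      using card_mono[of ?B "{1..n}"] by auto
    then obtain x where x: "x \<in> {1..n}" "x \<notin> ?B"
      by blast
    have "C m i ! j \<noteq> x" if "i < k" "q * d \<le> m + j" "m + j \<le> q * d + d" for i m
    proof -
      have "f (i, m + j - q * d) = C m i ! j"
        using that by (simp add: f_def)
      moreover have "(i, m + j - q * d) \<in> {..<k} \<times> {..d}"
        using that by auto
      ultimately have "C m i ! j \<in> ?B"
        by (metis image_eqI)
      with x show ?thesis
        by blast
    qed
    with x(1) show ?thesis
      unfolding allowed_def by blast
  qed
  then obtain g where g: "\<And>j q. allowed j q (g j q)"
    by metis
  have g_range: "g j q \<in> {1..n}" for j q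
    using g[of j q] unfolding allowed_def by blast
  have g_avoids: "C m i ! j \<noteq> g j q" if "i < k" "q * d \<le> m + j" "m + j \<le> q * d + d" for i j q m
    using g[of j q] that unfolding allowed_def by blast
  define r where "r t = map (\<lambda>j. g j ((t + j) div d)) [0..<d]" for t
  have r_nth: "r t ! j = g j ((t + j) div d)" if "j < d" for t j
    using that by (simp add: r_def)
  have r_vert: "r t \<in> pverts (hamming_graph d n)" for t
    using g_range by (auto simp: r_def mem_pverts_hamming_graph)
  have "legal_move (hamming_graph d n) (r t) (r (Suc t))" for t
  proof -
    let ?D = "{j. j < d \<and> r t ! j \<noteq> r (Suc t) ! j}"
    have D_dvd: "d dvd Suc t + j" if "j \<in> ?D" for j
      using that by (auto simp: r_nth div_Suc dvd_eq_mod_eq_0 split: if_splits)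
    have "j = j'" if "j \<in> ?D" "j' \<in> ?D" for j j'
    proof -
      have "[Suc t + j = Suc t + j'] (mod d)"
        using D_dvd[OF that(1)] D_dvd[OF that(2)] by (simp add: cong_def dvd_eq_mod_eq_0)
      then have "[j = j'] (mod d)"
        by (simp only: cong_add_lcancel_nat)
      with that show ?thesis
        by (auto simp: cong_def)
    qed
    then consider "?D = {}" | j where "?D = {j}"
      by blast
    then show ?thesis
    proof cases
      case 1
      then have "r (Suc t) = r t"
        by (intro nth_equalityI) (auto simp: r_def)
      then show ?thesis
        by (simp add: legal_move_def)
    next
      case 2
      then show ?thesis
        by (simp add: legal_move_def mem_parcs_hamming_graph r_vert)
    qed
  qed
  then have "robber_play (hamming_graph d n) r"
    by (simp add: robber_play_def r_vert)
  moreover have "\<not> cops_see (hamming_graph d n) (d - 1) k (C m) (r t)"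
    if "m = t \<or> m = Suc t" for m t
  proof (rule not_cops_see_if_no_agreement[OF d])
    fix i j
    assume "i < k" "j < d"
    have "(t + j) div d * d \<le> t + j" "t + j < (t + j) div d * d + d"
      using d dividend_less_div_times[of d "t + j"] by simp_all
    moreover have "t \<le> m" "m \<le> Suc t"
      using that by auto
    ultimately have "(t + j) div d * d \<le> m + j" "m + j \<le> (t + j) div d * d + d"
      by linarith+
    then show "C m i ! j \<noteq> r t ! j"
      unfolding r_nth[OF \<open>j < d\<close>] by (rule g_avoids[OF \<open>i < k\<close>])
  qed
  ultimately show ?thesis
    by blast
qed

section \<open>The bound\<close>

text \<open>
  Since \<open>seeing_cop_number\<close> is a \<open>LEAST\<close>, a lower bound for successful teams bounds it
  only once some team is known to succeed. Here a cop stands on every vertex.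
\<close>

lemma can_see_robber_card_pverts:
  assumes "pair_graph G"
  shows "can_see_robber G l (card (pverts G))"
proof -
  interpret pair_graph G
    by (rule assms)
  obtain c where c: "bij_betw c {..<card (pverts G)} (pverts G)"
    using ex_bij_betw_nat_finite[of "pverts G"] by (auto simp: atLeast0LessThan)
  define \<sigma> where "\<sigma> = (\<lambda>h :: 'a option list. c)"
  have pos: "cop_positions G l k \<sigma> r t = c" for k r t
    by (cases t) (simp_all add: \<sigma>_def)
  have self: "graph_dist G v v \<le> 0" if "v \<in> pverts G" for v
  proof -
    have "awalk v [] v"
      using that by (simp add: awalk_Nil_iff)
    from min_cost_le_walk_cost[OF this, of "\<lambda>_. 1"] show ?thesis
      by (simp add: graph_dist_def zero_ereal_def)
  qed
  have "cops_see G l (card (pverts G)) c v" if v: "v \<in> pverts G" for v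
  proof -
    have "v \<in> c ` {..<card (pverts G)}"
      using v by (simp add: bij_betw_imp_surj_on[OF c])
    then obtain i where "i < card (pverts G)" "c i = v"
      by blast
    moreover have "graph_dist G v v \<le> ereal (real l)"
      by (rule order_trans[OF self[OF v]]) simp
    ultimately show ?thesis
      unfolding cops_see_def by blast
  qed
  then have "seen_within G l (card (pverts G)) \<sigma> r 0" if "robber_play G r" for r
    using that by (auto simp: seen_within_def pos robber_play_def simp del: cop_positions.simps)
  moreover have "legal_strategy G l (card (pverts G)) \<sigma>"
    using c by (auto simp: legal_strategy_def pos legal_move_def simp del: cop_positions.simps dest: bij_betwE)
  ultimately show ?thesis
    unfolding can_see_robber_def by blast
qed

theorem theorem4p6:
  fixes n d :: nat
  assumes "d \<ge> 1" and "n \<ge> 3"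
  shows "int (seeing_cop_number (d - 1) (hamming_graph d n)) \<ge> \<lceil>real n / real (d + 1)\<rceil>"
proof -
  let ?G = "hamming_graph d n"
  let ?k = "seeing_cop_number (d - 1) ?G"
  have "replicate d 1 \<in> pverts ?G"
    using assms by (auto simp: mem_pverts_hamming_graph)
  moreover have "finite (pverts ?G)"
  proof -
    interpret pair_graph ?G
      by (rule pair_graph_hamming_graph)
    show ?thesis
      by simp
  qed
  ultimately have "card (pverts ?G) \<ge> 1"
    by (auto simp: Suc_le_eq card_gt_0_iff)
  then have "\<exists>k. k \<ge> 1 \<and> can_see_robber ?G (d - 1) k"
    using can_see_robber_card_pverts[OF pair_graph_hamming_graph] by blast
  then have "can_see_robber ?G (d - 1) ?k"
    unfolding seeing_cop_number_def by (rule LeastI2_ex) simp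
  then have "\<not> ?k * (d + 1) < n"
    using not_can_see_robber_if_evasion[OF hamming_graph_evasion[OF assms(1)]] by blast
  then have "real n \<le> real ?k * real (d + 1)"
    unfolding of_nat_mult[symmetric] of_nat_le_iff by simp
  then have "real n / real (d + 1) \<le> real ?k"
    by (simp add: pos_divide_le_eq)
  then show ?thesis
    by (simp add: ceiling_le_iff)
qed

end
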